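(* Let $K$ be a $\tfrac12$-lazy reversible transition kernel on a finite state space $\Omega$ with stationary distribution $\pi$. Let $Q(S,y)=\sum_{x\in S}\pi(x)K(x,y)$ for $S\subset\Omega$ and $y\in\Omega$. Assume that there are constants $0<\beta,\gamma<1$ such that for every $S\subset\Omega$ with $\pi(S)\le\beta$ and every $y\in\Omega$ with $\pi(y)>0$, $$\frac{Q(S,y)}{\pi(y)}\le 1-\gamma.$$ Fix a representation $$K(x,\cdot)=\alpha_x\delta_x(\cdot)+(1-\alpha_x)\sum_{U\subset\Omega}K_{x,U}\,\pi|_U(\cdot),\qquad x\in\Omega,$$ where $\tfrac12\le\alpha_x<1$ and, for each $x$, $\{K_{x,U}\}_{U\subset\Omega}$ is a probability distribution on the set of subsets of $\Omega$, and set $$\pi_*:=\inf\{\pi(U): \exists\,x\in\Omega\text{ such that }K_{x,U}>0\}.$$ Let $\tau$ be the mixing time of $K$ and $\Phi$ its conductance, and assume $\Phi\le\tfrac14$. Then $$\frac{1}{4\Phi}\ \le\ \tau\ \le\ \frac{32}{\gamma\,\Phi^2}\,\log\left(\frac{4}{\pi_*}\right)\log\left(\frac{2}{\sqrt{\beta}}\right).$$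
   Context: $K$ is $\tfrac12$-lazy if $K(x,x)\ge\tfrac12$ for all $x\in\Omega$. For a set $U$ with $\pi(U)>0$, $\pi|_U(A)=\pi(U\cap A)/\pi(U)$; in the representation $K_{x,U}>0$ is only allowed when $\pi(U)>0$. Ergodic flow: $Q(x,y)=\pi(x)K(x,y)$ and $Q(A,B)=\sum_{x\in A,y\in B}Q(x,y)$ (zero if $A$ or $B$ is empty). Conductance: $\Phi(S)=Q(S,S^c)/\pi(S)$ for $\pi(S)>0$, and $\Phi=\inf\{\Phi(S):0<\pi(S)\le\tfrac12\}$. Mixing time: $\tau:=\inf\{t:\ \sup_{x\in\Omega}\|K^t(x,\cdot)-\pi\|_{TV}<\tfrac14\}$, where $\|\mu-\nu\|_{TV}=\sup_{A}(\mu(A)-\nu(A))$.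
   Formalization: The formal theorem additionally assumes π(x)>0 for every state x∈Ω; without this the upper bound fails, since a state with π(x)=0 and α_x close to 1 makes τ arbitrarily large while the right-hand side stays fixed. *)

theory Defs
  imports "HOL-Probability.Probability"
begin

text \<open>
  A transition kernel on a finite state space is a function \<open>K :: 'a \<Rightarrow> 'a pmf\<close>, where \<open>K x\<close>
  is the law \<open>K(x,\<cdot>)\<close> of the next state.
\<close>

definition stationary :: "('a \<Rightarrow> 'a pmf) \<Rightarrow> 'a pmf \<Rightarrow> bool" where
  "stationary K \<pi> \<longleftrightarrow> bind_pmf \<pi> K = \<pi>"

definition ergodic_flow :: "('a \<Rightarrow> 'a pmf) \<Rightarrow> 'a pmf \<Rightarrow> 'a \<Rightarrow> 'a \<Rightarrow> real" where
  "ergodic_flow K \<pi> x y = pmf \<pi> x * pmf (K x) y"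

definition set_flow :: "('a::finite \<Rightarrow> 'a pmf) \<Rightarrow> 'a pmf \<Rightarrow> 'a set \<Rightarrow> 'a set \<Rightarrow> real" where
  "set_flow K \<pi> A B = (\<Sum>x\<in>A. \<Sum>y\<in>B. ergodic_flow K \<pi> x y)"

definition reversible :: "('a \<Rightarrow> 'a pmf) \<Rightarrow> 'a pmf \<Rightarrow> bool" where
  "reversible K \<pi> \<longleftrightarrow> (\<forall>x y. ergodic_flow K \<pi> x y = ergodic_flow K \<pi> y x)"

definition half_lazy :: "('a \<Rightarrow> 'a pmf) \<Rightarrow> bool" where
  "half_lazy K \<longleftrightarrow> (\<forall>x. pmf (K x) x \<ge> 1 / 2)"

definition set_conductance :: "('a::finite \<Rightarrow> 'a pmf) \<Rightarrow> 'a pmf \<Rightarrow> 'a set \<Rightarrow> real" where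
  "set_conductance K \<pi> S = set_flow K \<pi> S (- S) / measure_pmf.prob \<pi> S"

text \<open>Extended-real valued, so that the infimum over an empty family of sets is \<open>\<infinity>\<close>.\<close>

definition conductance :: "('a::finite \<Rightarrow> 'a pmf) \<Rightarrow> 'a pmf \<Rightarrow> ereal" where
  "conductance K \<pi> =
     (INF S\<in>{S. 0 < measure_pmf.prob \<pi> S \<and> measure_pmf.prob \<pi> S \<le> 1 / 2}.
        ereal (set_conductance K \<pi> S))"

primrec kernel_pow :: "('a \<Rightarrow> 'a pmf) \<Rightarrow> nat \<Rightarrow> 'a \<Rightarrow> 'a pmf" where
  "kernel_pow K 0 x = return_pmf x"
| "kernel_pow K (Suc t) x = bind_pmf (K x) (kernel_pow K t)"

definition tv_dist :: "'a pmf \<Rightarrow> 'a pmf \<Rightarrow> real" where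
  "tv_dist \<mu> \<nu> = (SUP A. measure_pmf.prob \<mu> A - measure_pmf.prob \<nu> A)"

text \<open>Extended-real valued: the mixing time of a chain that never mixes is \<open>\<infinity>\<close>.\<close>

definition mixing_time :: "('a::finite \<Rightarrow> 'a pmf) \<Rightarrow> 'a pmf \<Rightarrow> ereal" where
  "mixing_time K \<pi> =
     (INF t\<in>{t. (SUP x. tv_dist (kernel_pow K t x) \<pi>) < 1 / 4}. ereal (real t))"

text \<open>The measure \<open>\<pi>|\<^sub>U\<close>, meaningful only when \<open>\<pi>(U) > 0\<close>.\<close>

definition restricted :: "'a pmf \<Rightarrow> 'a set \<Rightarrow> 'a set \<Rightarrow> real" where
  "restricted \<pi> U A = measure_pmf.prob \<pi> (U \<inter> A) / measure_pmf.prob \<pi> U"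

text \<open>The numbers \<open>K\<^bsub>x,U\<^esub>\<close> of a representation are \<open>pmf (W x) U\<close>.\<close>

definition pi_star :: "'a pmf \<Rightarrow> ('a \<Rightarrow> 'a set pmf) \<Rightarrow> real" where
  "pi_star \<pi> W = Inf {measure_pmf.prob \<pi> U | U. \<exists>x. pmf (W x) U > 0}"

end

theory Submission
  imports Defs
begin

text \<open>
  Lower bound: started from \<open>\<pi>|\<^sub>S\<close> with \<open>S\<close> of minimal conductance, the chain leaves \<open>S\<close> with
  probability at most \<open>t \<Phi>\<close> within \<open>t\<close> steps.

  Upper bound: let \<open>g\<^sub>t(x) = K\<^sup>t(x,A) - \<pi>(A)\<close>. Cheeger's inequality and laziness give
  \<open>\<parallel>g\<^sub>t\<parallel>\<^sup>2 \<le> exp (- \<Phi>\<^sup>2 t / 2) / 4\<close> in \<open>L\<^sup>2(\<pi>)\<close>. This controls \<open>g\<^sub>t(x)\<close> directly when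
  \<open>\<pi>(x) \<ge> \<beta>\<close>. Otherwise the singleton \<open>{x}\<close> is a small set, so \<open>\<alpha>\<^sub>x \<le> 1 - \<gamma>\<close>: the chain holds
  at \<open>x\<close> for \<open>n\<close> steps with probability at most \<open>(1 - \<gamma>)\<^sup>n\<close>, and when it is resampled from
  some \<open>\<pi>|\<^sub>U\<close>, the average of \<open>g\<^sub>s\<close> over \<open>U\<close> is at most \<open>\<parallel>g\<^sub>s\<parallel> / sqrt \<pi>\<^sub>*\<close>.
\<close>

section \<open>Averages and medians of a finite distribution\<close>

text \<open>The variance of \<open>f\<close> around its mean \<open>m\<close> is nonnegative:
  Jensen's inequality for the square, used below for a lazy step and for averages over a
  set.\<close>

lemma weighted_sum_square_le:
  fixes w f :: "'a::finite \<Rightarrow> real"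
  assumes "\<And>y. 0 \<le> w y" and "sum w UNIV = 1"
  shows "(\<Sum>y\<in>UNIV. w y * f y)\<^sup>2 \<le> (\<Sum>y\<in>UNIV. w y * (f y)\<^sup>2)"
proof -
  define m where "m = (\<Sum>y\<in>UNIV. w y * f y)"
  have "0 \<le> (\<Sum>y\<in>UNIV. w y * (f y - m)\<^sup>2)"
    using assms by (intro sum_nonneg) auto
  also have "\<dots> = (\<Sum>y\<in>UNIV. w y * (f y)\<^sup>2 - 2 * m * (w y * f y) + m\<^sup>2 * w y)"
    by (intro sum.cong) (auto simp: power2_eq_square algebra_simps)
  also have "\<dots> = (\<Sum>y\<in>UNIV. w y * (f y)\<^sup>2) - 2 * m * m + m\<^sup>2 * sum w UNIV"
    by (simp add: sum.distrib sum_subtractf sum_distrib_left[symmetric] m_def)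
  finally show ?thesis
    using assms(2) by (simp add: m_def power2_eq_square)
qed

lemma prob_eq_sum_pmf:
  fixes M :: "'a::finite pmf"
  shows "measure_pmf.prob M A = sum (pmf M) A"
  by (simp add: measure_measure_pmf_finite)

lemma sum_pmf_UNIV: "sum (pmf (M :: 'a::finite pmf)) UNIV = 1"
  by (simp add: sum_pmf_eq_1)

text \<open>The least value of \<open>f\<close> whose lower level set has mass at least 1/2 is a
  median.\<close>

lemma ex_median:
  fixes f :: "'a::finite \<Rightarrow> real" and M :: "'a pmf"
  obtains m where "measure_pmf.prob M {x. f x > m} \<le> 1 / 2"
    and "measure_pmf.prob M {x. f x < m} \<le> 1 / 2"
proof -
  define V where "V = {v \<in> range f. 1 / 2 \<le> measure_pmf.prob M {x. f x \<le> v}}"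
  have "{x. f x \<le> Max (range f)} = UNIV" by auto
  then have "Max (range f) \<in> V"
    unfolding V_def by auto
  moreover have fin: "finite V" unfolding V_def by auto
  ultimately have mV: "Min V \<in> V" by (metis Min_in empty_iff)
  have "{x. f x > Min V} = - {x. f x \<le> Min V}" by auto
  then have 1: "measure_pmf.prob M {x. f x > Min V} \<le> 1 / 2"
    using mV measure_pmf.prob_compl[of "{x. f x \<le> Min V}" M]
    by (simp add: V_def Compl_eq_Diff_UNIV)
  have 2: "measure_pmf.prob M {x. f x < Min V} \<le> 1 / 2"
  proof (cases "{x. f x < Min V} = {}")
    case False
    \<comment> \<open>The next smaller value of \<open>f\<close>; its lower level set is all of
      \<open>{x. f x < Min V}\<close> and, by minimality, has mass below 1/2.\<close>
    define v where "v = Max (f ` {x. f x < Min V})"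
    have v: "v \<in> f ` {x. f x < Min V}"
      unfolding v_def using False by (intro Max_in) auto
    have "{x. f x < Min V} = {x. f x \<le> v}"
    proof (intro set_eqI iffI)
      fix x assume "x \<in> {x. f x < Min V}"
      then show "x \<in> {x. f x \<le> v}" by (simp add: v_def)
    qed (use v in auto)
    moreover have "v \<notin> V" using v fin by (metis (lifting) Min_le imageE leD mem_Collect_eq)
    ultimately show ?thesis
      using v by (auto simp: V_def)
  qed simp
  show thesis using that[OF 1 2] .
qed

section \<open>Symmetric flow of a reversible chain\<close>

locale reversible_chain =
  fixes K :: "'a::finite \<Rightarrow> 'a pmf" and \<pi> :: "'a pmf"
  assumes rev: "reversible K \<pi>"
begin

abbreviation flow :: "'a \<Rightarrow> 'a \<Rightarrow> real" where
  "flow \<equiv> ergodic_flow K \<pi>"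

definition step :: "('a \<Rightarrow> real) \<Rightarrow> 'a \<Rightarrow> real" where
  "step f x = (\<Sum>y\<in>UNIV. pmf (K x) y * f y)"

text \<open>The energy \<open><f, (I - K) f>\<close> in L2(\<pi>), by
  \<open>dirichlet_eq_inner\<close>; the 1/2 compensates for summing each pair in both
  orders.\<close>

definition dirichlet :: "('a \<Rightarrow> real) \<Rightarrow> real" where
  "dirichlet f = (\<Sum>x\<in>UNIV. \<Sum>y\<in>UNIV. flow x y * (f x - f y)\<^sup>2) / 2"

lemma flow_commute: "flow x y = flow y x"
  using rev by (simp add: reversible_def)

lemma flow_nonneg: "0 \<le> flow x y"
  by (simp add: ergodic_flow_def)

lemma sum_flow_right: "(\<Sum>y\<in>UNIV. flow x y) = pmf \<pi> x"
  by (simp add: ergodic_flow_def sum_distrib_left[symmetric] sum_pmf_UNIV)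

lemma sum_flow_left: "(\<Sum>x\<in>UNIV. flow x y) = pmf \<pi> y"
  using sum_flow_right[of y] by (simp add: flow_commute)

lemma sum_sum_flow_fst: "(\<Sum>x\<in>UNIV. \<Sum>y\<in>UNIV. flow x y * h x) = (\<Sum>x\<in>UNIV. pmf \<pi> x * h x)"
  by (simp add: sum_distrib_right[symmetric] sum_flow_right)

lemma sum_sum_flow_snd: "(\<Sum>x\<in>UNIV. \<Sum>y\<in>UNIV. flow x y * h y) = (\<Sum>x\<in>UNIV. pmf \<pi> x * h x)"
  by (subst sum.swap) (simp add: sum_distrib_right[symmetric] sum_flow_left)

lemma set_flow_commute: "set_flow K \<pi> A B = set_flow K \<pi> B A"
  unfolding set_flow_def by (subst sum.swap) (simp add: flow_commute)

lemma set_flow_nonneg: "0 \<le> set_flow K \<pi> A B"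
  unfolding set_flow_def by (intro sum_nonneg flow_nonneg)

lemma set_flow_eq_sum_indicator:
  "set_flow K \<pi> A B = (\<Sum>x\<in>UNIV. \<Sum>y\<in>UNIV. flow x y * (indicator A x * indicator B y))"
proof -
  have "(\<Sum>y\<in>UNIV. flow x y * (indicator A x * indicator B y))
      = indicator A x * (\<Sum>y\<in>B. flow x y)" for x
    by (simp add: indicator_def sum_distrib_left sum.If_cases if_distrib cong: if_cong)
  then show ?thesis
    by (simp add: set_flow_def indicator_def sum.If_cases if_distrib cong: if_cong)
qed

text \<open>Each crossing pair is summed in both orders, and symmetry makes the two flows equal. In
  \<open>coarea\<close> this prices one level set.\<close>

lemma sum_flow_indicator_diff:
  "(\<Sum>x\<in>UNIV. \<Sum>y\<in>UNIV. flow x y * \<bar>indicator S x - indicator S y\<bar>)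
     = 2 * set_flow K \<pi> S (- S)"
proof -
  have "(\<Sum>x\<in>UNIV. \<Sum>y\<in>UNIV. flow x y * \<bar>indicator S x - indicator S y\<bar>)
      = (\<Sum>x\<in>UNIV. \<Sum>y\<in>UNIV. flow x y * (indicator S x * indicator (- S) y)
          + flow x y * (indicator (- S) x * indicator S y))"
    by (intro sum.cong refl) (auto simp: indicator_def)
  also have "\<dots> = set_flow K \<pi> S (- S) + set_flow K \<pi> (- S) S"
    by (simp add: set_flow_eq_sum_indicator sum.distrib)
  finally show ?thesis by (simp add: set_flow_commute[of "- S"])
qed

section \<open>Conductance and Cheeger's inequality\<close>

text \<open>Null sets lie outside the infimum, but for them the claim is just that flow is
  nonnegative. The real \<phi> stands in for the extended-real \<open>conductance\<close>.\<close>

lemma conductance_flow_bound: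
  assumes "ereal \<phi> \<le> conductance K \<pi>" and "measure_pmf.prob \<pi> S \<le> 1 / 2"
  shows "\<phi> * measure_pmf.prob \<pi> S \<le> set_flow K \<pi> S (- S)"
proof (cases "measure_pmf.prob \<pi> S = 0")
  case False
  then have pos: "0 < measure_pmf.prob \<pi> S"
    by (simp add: zero_less_measure_iff)
  have "conductance K \<pi> \<le> ereal (set_conductance K \<pi> S)"
    unfolding conductance_def using pos assms by (intro INF_lower) auto
  then have "\<phi> \<le> set_conductance K \<pi> S"
    using assms(1) by (metis ereal_less_eq(3) order_trans)
  then show ?thesis
    using pos by (simp add: set_conductance_def field_simps)
qed (simp add: set_flow_nonneg)

text \<open>The discrete co-area inequality; the induction peels off the lowest positive level of \<open>h\<close>.\<close>

lemma coarea:
  assumes \<phi>: "ereal \<phi> \<le> conductance K \<pi>"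
    and "\<And>x. 0 \<le> h x" and "measure_pmf.prob \<pi> {x. 0 < h x} \<le> 1 / 2"
  shows "\<phi> * (\<Sum>x\<in>UNIV. pmf \<pi> x * h x)
           \<le> (\<Sum>x\<in>UNIV. \<Sum>y\<in>UNIV. flow x y * \<bar>h x - h y\<bar>) / 2"
  using assms(2,3)
proof (induction "card {x. 0 < h x}" arbitrary: h rule: less_induct)
  case less
  define S where "S = {x. 0 < h x}"
  show ?case
  proof (cases "S = {}")
    case True
    then have "h x = 0" for x
      using less.prems(1)[of x] by (auto simp: S_def order.antisym not_less)
    then show ?thesis by simp
  next
    case False
    define a where "a = Min (h ` S)"
    define g where "g x = h x - a * indicator S x" for x
    have aS: "a \<in> h ` S" unfolding a_def using False by (intro Min_in) auto
    then have a_pos: "0 < a" by (auto simp: S_def)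
    have a_le: "a \<le> h x" if "x \<in> S" for x
      unfolding a_def using that by (intro Min_le) auto
    have h0: "h x = 0" if "x \<notin> S" for x
      using that less.prems(1)[of x] by (simp add: S_def order.antisym not_less)
    have g_nonneg: "0 \<le> g x" for x
      using a_le[of x] less.prems(1)[of x] by (auto simp: g_def indicator_def)
    \<comment> \<open>At \<open>z\<close> the lowest level is attained, so \<open>z\<close> drops
      out of the support of \<open>g\<close> and the induction measure decreases.\<close>
    obtain z where z: "z \<in> S" "h z = a" using aS by auto
    have sub: "{x. 0 < g x} \<subseteq> S - {z}"
    proof
      fix x assume "x \<in> {x. 0 < g x}"
      then show "x \<in> S - {z}"
        using z h0[of x] by (cases "x \<in> S") (auto simp: g_def)
    qed
    then have card: "card {x. 0 < g x} < card {x. 0 < h x}"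
      using z unfolding S_def by (intro psubset_card_mono) auto
    have prob: "measure_pmf.prob \<pi> {x. 0 < g x} \<le> 1 / 2"
      by (rule order_trans[OF measure_pmf.finite_measure_mono less.prems(2)])
        (use sub in \<open>auto simp: S_def\<close>)
    \<comment> \<open>Across the boundary of \<open>S\<close> both terms on the right have the same
      sign, because \<open>a\<close> is at most \<open>h\<close> on \<open>S\<close> and
      \<open>h\<close> vanishes outside.\<close>
    have abs: "\<bar>h x - h y\<bar> = \<bar>g x - g y\<bar> + a * \<bar>indicator S x - indicator S y\<bar>" for x y
      using a_pos a_le[of x] a_le[of y] h0[of x] h0[of y]
      by (auto simp: g_def indicator_def)
    have "(\<Sum>x\<in>UNIV. pmf \<pi> x * h x)
        = (\<Sum>x\<in>UNIV. pmf \<pi> x * g x + a * (pmf \<pi> x * indicator S x))"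
      by (intro sum.cong) (auto simp: g_def algebra_simps)
    also have "\<dots> = (\<Sum>x\<in>UNIV. pmf \<pi> x * g x) + a * measure_pmf.prob \<pi> S"
      by (simp add: sum.distrib sum_distrib_left[symmetric] prob_eq_sum_pmf indicator_def
          if_distrib sum.If_cases cong: if_cong)
    finally have lhs: "\<phi> * (\<Sum>x\<in>UNIV. pmf \<pi> x * h x)
        = \<phi> * (\<Sum>x\<in>UNIV. pmf \<pi> x * g x) + a * (\<phi> * measure_pmf.prob \<pi> S)"
      by (simp add: algebra_simps)
    have "(\<Sum>x\<in>UNIV. \<Sum>y\<in>UNIV. flow x y * \<bar>h x - h y\<bar>)
        = (\<Sum>x\<in>UNIV. \<Sum>y\<in>UNIV. flow x y * \<bar>g x - g y\<bar>
            + a * (flow x y * \<bar>indicator S x - indicator S y\<bar>))"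
      by (simp add: abs algebra_simps)
    also have "\<dots> = (\<Sum>x\<in>UNIV. \<Sum>y\<in>UNIV. flow x y * \<bar>g x - g y\<bar>)
        + a * (2 * set_flow K \<pi> S (- S))"
      by (simp only: sum.distrib sum_distrib_left[symmetric] sum_flow_indicator_diff)
    finally have rhs: "(\<Sum>x\<in>UNIV. \<Sum>y\<in>UNIV. flow x y * \<bar>h x - h y\<bar>) / 2
        = (\<Sum>x\<in>UNIV. \<Sum>y\<in>UNIV. flow x y * \<bar>g x - g y\<bar>) / 2 + a * set_flow K \<pi> S (- S)"
      by (simp add: field_simps)
    have "a * (\<phi> * measure_pmf.prob \<pi> S) \<le> a * set_flow K \<pi> S (- S)"
      using conductance_flow_bound[OF \<phi>, of S] less.prems(2) a_pos
      by (intro mult_left_mono) (auto simp: S_def)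
    then show ?thesis
      unfolding lhs rhs using less.hyps[OF card g_nonneg prob] by linarith
  qed
qed

text \<open>Apply \<open>coarea\<close> to the square of \<open>g\<close>, factor the difference of
  squares, and separate the factors by a weighted AM-GM inequality.\<close>

lemma cheeger_nonneg:
  assumes \<phi>: "ereal \<phi> \<le> conductance K \<pi>" and "0 \<le> \<phi>"
    and nonneg: "\<And>x. 0 \<le> g x" and half: "measure_pmf.prob \<pi> {x. 0 < g x} \<le> 1 / 2"
  shows "\<phi>\<^sup>2 / 2 * (\<Sum>x\<in>UNIV. pmf \<pi> x * (g x)\<^sup>2) \<le> dirichlet g"
proof (cases "\<phi> = 0")
  case True
  then show ?thesis
    by (auto simp: dirichlet_def intro!: sum_nonneg mult_nonneg_nonneg flow_nonneg)
next
  case False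
  with assms have pos: "0 < \<phi>" by simp
  define N where "N = (\<Sum>x\<in>UNIV. pmf \<pi> x * (g x)\<^sup>2)"
  have "{x. 0 < (g x)\<^sup>2} = {x. 0 < g x}"
    using nonneg by (metis (no_types, lifting) less_eq_real_def power_zero_numeral
        zero_less_power)
  then have "\<phi> * N \<le> (\<Sum>x\<in>UNIV. \<Sum>y\<in>UNIV. flow x y * \<bar>(g x)\<^sup>2 - (g y)\<^sup>2\<bar>) / 2"
    unfolding N_def using half by (intro coarea[OF \<phi>]) auto
  also have "(\<Sum>x\<in>UNIV. \<Sum>y\<in>UNIV. flow x y * \<bar>(g x)\<^sup>2 - (g y)\<^sup>2\<bar>)
      \<le> (\<Sum>x\<in>UNIV. \<Sum>y\<in>UNIV. 1 / \<phi> * (flow x y * (g x - g y)\<^sup>2)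
           + (\<phi> / 2 * (flow x y * (g x)\<^sup>2) + \<phi> / 2 * (flow x y * (g y)\<^sup>2)))"
  proof (intro sum_mono)
    fix x y
    \<comment> \<open>The weights are chosen so that the non-gradient part sums to
      \<open>\<phi> * N\<close>; half of it enters the bound and is absorbed on the left.\<close>
    have "0 \<le> (2 * \<bar>g x - g y\<bar> - \<phi> * (g x + g y))\<^sup>2" by simp
    then have "4 * \<phi> * (\<bar>g x - g y\<bar> * (g x + g y))
        \<le> 4 * (g x - g y)\<^sup>2 + \<phi>\<^sup>2 * (g x + g y)\<^sup>2"
      unfolding power2_diff[of "2 * \<bar>g x - g y\<bar>"] power_mult_distrib power2_abs by (simp add: mult_ac)
    also have "(g x + g y)\<^sup>2 \<le> 2 * (g x)\<^sup>2 + 2 * (g y)\<^sup>2"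
      using sum_squares_bound[of "g x" "g y"] by (simp add: power2_sum)
    then have "\<phi>\<^sup>2 * (g x + g y)\<^sup>2 \<le> \<phi>\<^sup>2 * (2 * (g x)\<^sup>2 + 2 * (g y)\<^sup>2)"
      by (intro mult_left_mono) auto
    finally have "4 * \<phi> * (\<bar>g x - g y\<bar> * (g x + g y))
        \<le> 4 * (g x - g y)\<^sup>2 + \<phi>\<^sup>2 * (2 * (g x)\<^sup>2 + 2 * (g y)\<^sup>2)"
      by simp
    also have "\<dots>
        = 4 * \<phi> * (1 / \<phi> * (g x - g y)\<^sup>2 + (\<phi> / 2 * (g x)\<^sup>2 + \<phi> / 2 * (g y)\<^sup>2))"
      using pos by (simp add: distrib_left power2_eq_square[of \<phi>])
    finally have "4 * \<phi> * (\<bar>g x - g y\<bar> * (g x + g y))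
        \<le> 4 * \<phi> * (1 / \<phi> * (g x - g y)\<^sup>2 + (\<phi> / 2 * (g x)\<^sup>2 + \<phi> / 2 * (g y)\<^sup>2))" .
    then have "\<bar>g x - g y\<bar> * (g x + g y)
        \<le> 1 / \<phi> * (g x - g y)\<^sup>2 + (\<phi> / 2 * (g x)\<^sup>2 + \<phi> / 2 * (g y)\<^sup>2)"
      using pos by (simp only: mult_le_cancel_left_pos mult_pos_pos zero_less_numeral)
    moreover have "\<bar>(g x)\<^sup>2 - (g y)\<^sup>2\<bar> = \<bar>g x - g y\<bar> * (g x + g y)"
      using nonneg[of x] nonneg[of y]
      by (simp add: power2_eq_square square_diff_square_factored abs_mult)
    ultimately show "flow x y * \<bar>(g x)\<^sup>2 - (g y)\<^sup>2\<bar> \<le> 1 / \<phi> * (flow x y * (g x - g y)\<^sup>2)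
           + (\<phi> / 2 * (flow x y * (g x)\<^sup>2) + \<phi> / 2 * (flow x y * (g y)\<^sup>2))"
      using mult_left_mono[OF _ flow_nonneg[of x y]] by (fastforce simp: algebra_simps)
  qed
  also have "\<dots> = 2 / \<phi> * dirichlet g + \<phi> * N"
    by (simp only: sum.distrib sum_distrib_left[symmetric] sum_sum_flow_fst sum_sum_flow_snd)
      (simp add: dirichlet_def N_def)
  finally have "\<phi> * N / 2 \<le> dirichlet g / \<phi>" by (simp add: field_simps)
  then show ?thesis
    unfolding N_def[symmetric] using pos by (simp add: field_simps power2_eq_square)
qed

text \<open>Cut \<open>f\<close> at a median \<open>m\<close>: the positive and negative parts of
  \<open>f - m\<close> each live on mass at most 1/2, so \<open>cheeger_nonneg\<close> applies to
  both.\<close>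

lemma cheeger:
  assumes \<phi>: "ereal \<phi> \<le> conductance K \<pi>" "0 \<le> \<phi>"
    and mean0: "(\<Sum>x\<in>UNIV. pmf \<pi> x * f x) = 0"
  shows "\<phi>\<^sup>2 / 2 * (\<Sum>x\<in>UNIV. pmf \<pi> x * (f x)\<^sup>2) \<le> dirichlet f"
proof -
  obtain m where m: "measure_pmf.prob \<pi> {x. f x > m} \<le> 1 / 2"
      "measure_pmf.prob \<pi> {x. f x < m} \<le> 1 / 2"
    by (rule ex_median)
  define u where "u x = max 0 (f x - m)" for x
  define v where "v x = max 0 (m - f x)" for x
  have sets: "{x. 0 < u x} = {x. f x > m}" "{x. 0 < v x} = {x. f x < m}"
    by (auto simp: u_def v_def)
  have sq: "(f x - m)\<^sup>2 = (u x)\<^sup>2 + (v x)\<^sup>2" for x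
    by (auto simp: u_def v_def max_def power2_commute)
  \<comment> \<open>Since \<open>f\<close> has mean zero, shifting by \<open>m\<close> raises the
    second moment by exactly \<open>m\<^sup>2\<close>.\<close>
  have "(\<Sum>x\<in>UNIV. pmf \<pi> x * (f x)\<^sup>2)
      \<le> (\<Sum>x\<in>UNIV. pmf \<pi> x * (f x)\<^sup>2) - 2 * m * (\<Sum>x\<in>UNIV. pmf \<pi> x * f x)
          + m\<^sup>2 * sum (pmf \<pi>) UNIV"
    by (simp add: mean0 sum_pmf_UNIV)
  also have "\<dots> = (\<Sum>x\<in>UNIV. pmf \<pi> x * (f x - m)\<^sup>2)"
    by (simp add: power2_diff distrib_left right_diff_distrib sum.distrib sum_subtractf
        sum_distrib_left sum_distrib_right mult_ac)
  also have "\<dots> = (\<Sum>x\<in>UNIV. pmf \<pi> x * (u x)\<^sup>2) + (\<Sum>x\<in>UNIV. pmf \<pi> x * (v x)\<^sup>2)"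
    by (simp add: sq distrib_left sum.distrib)
  finally have "\<phi>\<^sup>2 / 2 * (\<Sum>x\<in>UNIV. pmf \<pi> x * (f x)\<^sup>2)
      \<le> \<phi>\<^sup>2 / 2 * ((\<Sum>x\<in>UNIV. pmf \<pi> x * (u x)\<^sup>2) + (\<Sum>x\<in>UNIV. pmf \<pi> x * (v x)\<^sup>2))"
    by (intro mult_left_mono) auto
  also have "\<dots> \<le> dirichlet u + dirichlet v"
    unfolding distrib_left using m sets
    by (intro add_mono cheeger_nonneg[OF \<phi>]) (auto simp: u_def v_def)
  also have "\<dots> = (\<Sum>x\<in>UNIV. \<Sum>y\<in>UNIV. flow x y * ((u x - u y)\<^sup>2 + (v x - v y)\<^sup>2)) / 2"
    by (simp add: dirichlet_def distrib_left sum.distrib add_divide_distrib)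
  also have "\<dots> \<le> dirichlet f"
    unfolding dirichlet_def
  proof (intro divide_right_mono sum_mono mult_left_mono flow_nonneg)
    fix x y
    \<comment> \<open>\<open>u\<close> increases and \<open>v\<close> decreases with
      \<open>f\<close>, so the cross term of the expanded square only adds energy to
      \<open>f\<close>.\<close>
    have "(u x - u y) * (v x - v y) \<le> 0"
      by (auto simp: u_def v_def max_def mult_le_0_iff)
    moreover have "f x - f y = (u x - u y) - (v x - v y)"
      by (auto simp: u_def v_def max_def)
    ultimately show "(u x - u y)\<^sup>2 + (v x - v y)\<^sup>2 \<le> (f x - f y)\<^sup>2"
      by (simp only: power2_diff[of "u x - u y"])
  qed simp
  finally show ?thesis .
qed

section \<open>Contraction of the variance in one step\<close>

text \<open>Stationarity on functions, obtained from the symmetry of the flow.\<close>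

lemma sum_pmf_step: "(\<Sum>x\<in>UNIV. pmf \<pi> x * step f x) = (\<Sum>x\<in>UNIV. pmf \<pi> x * f x)"
proof -
  have "(\<Sum>x\<in>UNIV. pmf \<pi> x * step f x) = (\<Sum>x\<in>UNIV. \<Sum>y\<in>UNIV. flow x y * f y)"
    by (simp add: step_def ergodic_flow_def sum_distrib_left mult.assoc)
  then show ?thesis by (simp add: sum_sum_flow_snd)
qed

text \<open>Expand the square; both marginals of the flow are \<pi>, so the two pure squares
  contribute equally.\<close>

lemma dirichlet_eq_inner:
  "dirichlet f = (\<Sum>x\<in>UNIV. pmf \<pi> x * (f x)\<^sup>2) - (\<Sum>x\<in>UNIV. pmf \<pi> x * (f x * step f x))"
proof -
  have "(\<Sum>x\<in>UNIV. \<Sum>y\<in>UNIV. flow x y * (f x - f y)\<^sup>2)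
      = (\<Sum>x\<in>UNIV. \<Sum>y\<in>UNIV. flow x y * (f x)\<^sup>2 + flow x y * (f y)\<^sup>2
           - 2 * (flow x y * (f x * f y)))"
    by (intro sum.cong refl) (simp add: power2_diff algebra_simps)
  also have "\<dots> = 2 * (\<Sum>x\<in>UNIV. pmf \<pi> x * (f x)\<^sup>2)
      - 2 * (\<Sum>x\<in>UNIV. \<Sum>y\<in>UNIV. flow x y * (f x * f y))"
    by (simp only: sum.distrib sum_subtractf sum_distrib_left[symmetric] sum_sum_flow_fst
        sum_sum_flow_snd mult_2)
  also have "(\<Sum>x\<in>UNIV. \<Sum>y\<in>UNIV. flow x y * (f x * f y))
      = (\<Sum>x\<in>UNIV. pmf \<pi> x * (f x * step f x))"
    by (simp add: step_def ergodic_flow_def sum_distrib_left mult_ac)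
  finally show ?thesis by (simp add: dirichlet_def)
qed

text \<open>Laziness makes \<open>P = 2K - I\<close> a Markov kernel, and \<open>\<parallel>Pf\<parallel> \<le> \<parallel>f\<parallel>\<close> rearranges to
  \<open>\<parallel>Kf\<parallel>\<^sup>2 \<le> \<langle>f, Kf\<rangle>\<close>.\<close>

lemma lazy_step_norm_le:
  assumes "half_lazy K"
  shows "(\<Sum>x\<in>UNIV. pmf \<pi> x * (step f x)\<^sup>2) \<le> (\<Sum>x\<in>UNIV. pmf \<pi> x * (f x * step f x))"
proof -
  define w where "w x y = 2 * pmf (K x) y - indicator {x} y" for x y
  have w_nonneg: "0 \<le> w x y" for x y
    using assms[unfolded half_lazy_def, rule_format, of x] by (simp add: w_def indicator_def)
  have ind: "(\<Sum>y\<in>UNIV. indicator {x} y * h y) = h x" for x and h :: "'a \<Rightarrow> real"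
    by (simp add: indicator_def if_distrib if_distribR sum.If_cases cong: if_cong)
  have w_app: "(\<Sum>y\<in>UNIV. w x y * h y) = 2 * step h x - h x" for x h
    by (simp add: w_def left_diff_distrib sum_subtractf step_def ind sum_distrib_left mult.assoc)
  have w_sum: "sum (w x) UNIV = 1" for x
    using w_app[of x "\<lambda>_. 1"] by (simp add: step_def sum_pmf_UNIV)
  have "(\<Sum>x\<in>UNIV. pmf \<pi> x * (2 * step f x - f x)\<^sup>2)
      \<le> (\<Sum>x\<in>UNIV. pmf \<pi> x * (2 * step (\<lambda>y. (f y)\<^sup>2) x - (f x)\<^sup>2))"
  proof (intro sum_mono mult_left_mono)
    fix x
    show "(2 * step f x - f x)\<^sup>2 \<le> 2 * step (\<lambda>y. (f y)\<^sup>2) x - (f x)\<^sup>2"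
      using weighted_sum_square_le[OF w_nonneg w_sum, of x f] by (simp add: w_app)
  qed simp
  also have "\<dots> = 2 * (\<Sum>x\<in>UNIV. pmf \<pi> x * step (\<lambda>y. (f y)\<^sup>2) x) - (\<Sum>x\<in>UNIV. pmf \<pi> x * (f x)\<^sup>2)"
    by (simp add: right_diff_distrib sum_subtractf sum_distrib_left mult_ac)
  also have "\<dots> = (\<Sum>x\<in>UNIV. pmf \<pi> x * (f x)\<^sup>2)"
    by (simp add: sum_pmf_step)
  also have "(\<Sum>x\<in>UNIV. pmf \<pi> x * (2 * step f x - f x)\<^sup>2)
      = (\<Sum>x\<in>UNIV. 4 * (pmf \<pi> x * (step f x)\<^sup>2) - 4 * (pmf \<pi> x * (f x * step f x))
          + pmf \<pi> x * (f x)\<^sup>2)"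
    by (intro sum.cong) (auto simp: power2_eq_square algebra_simps)
  also have "\<dots> = 4 * (\<Sum>x\<in>UNIV. pmf \<pi> x * (step f x)\<^sup>2)
      - 4 * (\<Sum>x\<in>UNIV. pmf \<pi> x * (f x * step f x)) + (\<Sum>x\<in>UNIV. pmf \<pi> x * (f x)\<^sup>2)"
    by (simp only: sum.distrib sum_subtractf sum_distrib_left[symmetric])
  finally show ?thesis by simp
qed

text \<open>Laziness bounds the squared norm of \<open>step f\<close> by \<open><f, step f>\<close>,
  which is the squared norm of \<open>f\<close> minus its energy; \<open>cheeger\<close> bounds the
  energy from below.\<close>

lemma step_variance_le:
  assumes "half_lazy K" "ereal \<phi> \<le> conductance K \<pi>" "0 \<le> \<phi>"
    and "(\<Sum>x\<in>UNIV. pmf \<pi> x * f x) = 0"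
  shows "(\<Sum>x\<in>UNIV. pmf \<pi> x * (step f x)\<^sup>2)
           \<le> (1 - \<phi>\<^sup>2 / 2) * (\<Sum>x\<in>UNIV. pmf \<pi> x * (f x)\<^sup>2)"
  using lazy_step_norm_le[OF assms(1), of f] cheeger[OF assms(2,3,4)]
  by (simp add: dirichlet_eq_inner algebra_simps)

section \<open>Decay of the deviation from stationarity\<close>

text \<open>Kept signed: \<open>tv_dist\<close> is a supremum of signed differences, so upper bounds
  for all \<open>A\<close> suffice.\<close>

definition excess :: "'a set \<Rightarrow> nat \<Rightarrow> 'a \<Rightarrow> real" where
  "excess A t x = measure_pmf.prob (kernel_pow K t x) A - measure_pmf.prob \<pi> A"

text \<open>\<open>kernel_pow\<close> peels off the first step, so for a fixed target
  \<open>A\<close> the probability evolves under \<open>step\<close> as a function of the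
  start.\<close>

lemma prob_kernel_pow_Suc:
  "measure_pmf.prob (kernel_pow K (Suc t) x) A
     = step (\<lambda>y. measure_pmf.prob (kernel_pow K t y) A) x"
proof -
  have "pmf (kernel_pow K (Suc t) x) z = step (\<lambda>y. pmf (kernel_pow K t y) z) x" for z
    by (simp add: pmf_bind step_def integral_measure_pmf_real[of UNIV] mult.commute)
  then show ?thesis
    unfolding prob_eq_sum_pmf step_def
    by (simp add: sum_distrib_left sum.swap[of _ A])
qed

lemma step_diff_const: "step (\<lambda>y. f y - c) x = step f x - c"
  by (simp add: step_def right_diff_distrib sum_subtractf sum_distrib_right[symmetric]
      sum_pmf_UNIV)

lemma excess_Suc: "excess A (Suc t) = step (excess A t)"
proof
  fix x
  have "excess A t = (\<lambda>y. measure_pmf.prob (kernel_pow K t y) A - measure_pmf.prob \<pi> A)"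
    by (simp add: excess_def fun_eq_iff)
  then show "excess A (Suc t) x = step (excess A t) x"
    by (simp add: step_diff_const prob_kernel_pow_Suc excess_def del: kernel_pow.simps)
qed

lemma excess_0: "excess A 0 x = indicator A x - measure_pmf.prob \<pi> A"
  by (simp add: excess_def)

lemma excess_le_1: "excess A t x \<le> 1"
  unfolding excess_def
  by (smt (verit) measure_nonneg measure_pmf.prob_le_1)

lemma sum_pmf_indicator: "(\<Sum>x\<in>UNIV. pmf \<pi> x * indicator A x) = measure_pmf.prob \<pi> A"
  by (simp add: prob_eq_sum_pmf indicator_def if_distrib sum.If_cases cong: if_cong)

lemma excess_mean: "(\<Sum>x\<in>UNIV. pmf \<pi> x * excess A t x) = 0"
proof (induction t)
  case 0
  show ?case
    by (simp add: excess_0 right_diff_distrib sum_subtractf sum_distrib_right[symmetric]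
        sum_pmf_UNIV sum_pmf_indicator)
qed (simp add: excess_Suc sum_pmf_step)

text \<open>The initial 1/4 bounds the variance of an indicator; each step then contracts by
  \<open>1 - \<phi>\<^sup>2 / 2\<close>, at most
  \<open>exp (- (\<phi>\<^sup>2 / 2))\<close>.\<close>

lemma excess_variance_le:
  assumes "half_lazy K" "ereal \<phi> \<le> conductance K \<pi>" "0 \<le> \<phi>" "\<phi> \<le> 1"
  shows "(\<Sum>x\<in>UNIV. pmf \<pi> x * (excess A t x)\<^sup>2) \<le> exp (- (\<phi>\<^sup>2 * t / 2)) / 4"
proof (induction t)
  case 0
  define a where "a = measure_pmf.prob \<pi> A"
  have "(\<Sum>x\<in>UNIV. pmf \<pi> x * (excess A 0 x)\<^sup>2)
      = (\<Sum>x\<in>UNIV. (1 - 2 * a) * (pmf \<pi> x * indicator A x) + a\<^sup>2 * pmf \<pi> x)"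
    by (intro sum.cong) (auto simp: excess_0 a_def indicator_def power2_eq_square algebra_simps)
  also have "\<dots> = (1 - 2 * a) * a + a\<^sup>2"
    by (simp only: sum.distrib sum_distrib_left[symmetric] sum_pmf_indicator sum_pmf_UNIV a_def
        mult_1_right)
  also have "\<dots> = 1 / 4 - (a - 1 / 2)\<^sup>2"
    by (simp add: power2_eq_square algebra_simps)
  also have "\<dots> \<le> 1 / 4" by simp
  finally show ?case by simp
next
  case (Suc t)
  have \<phi>2: "\<phi>\<^sup>2 \<le> 1" using assms by (simp add: power_le_one)
  have "(\<Sum>x\<in>UNIV. pmf \<pi> x * (excess A (Suc t) x)\<^sup>2)
      \<le> (1 - \<phi>\<^sup>2 / 2) * (\<Sum>x\<in>UNIV. pmf \<pi> x * (excess A t x)\<^sup>2)"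
    unfolding excess_Suc by (intro step_variance_le assms excess_mean)
  also have "\<dots> \<le> exp (- (\<phi>\<^sup>2 / 2)) * (exp (- (\<phi>\<^sup>2 * t / 2)) / 4)"
    using Suc \<phi>2 exp_ge_add_one_self[of "- (\<phi>\<^sup>2 / 2)"]
    by (intro mult_mono) (auto intro!: sum_nonneg)
  also have "\<dots> = exp (- (\<phi>\<^sup>2 * Suc t / 2)) / 4"
    by (simp add: exp_add[symmetric] algebra_simps add_divide_distrib)
  finally show ?case .
qed

section \<open>From variance to pointwise bounds\<close>

text \<open>The single summand at \<open>x\<close> is already at least \<beta> times the square of
  \<open>f x\<close>.\<close>

lemma excess_le_of_large_atom:
  assumes "\<beta> \<le> pmf \<pi> x" and "0 < \<beta>" and "0 < c"
    and "(\<Sum>x\<in>UNIV. pmf \<pi> x * (f x)\<^sup>2) < \<beta> * c\<^sup>2"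
  shows "f x < c"
proof -
  have "\<beta> * (f x)\<^sup>2 \<le> pmf \<pi> x * (f x)\<^sup>2"
    using assms by (intro mult_right_mono) auto
  also have "\<dots> \<le> (\<Sum>x\<in>UNIV. pmf \<pi> x * (f x)\<^sup>2)"
    by (rule member_le_sum) auto
  finally have "\<beta> * (f x)\<^sup>2 < \<beta> * c\<^sup>2"
    using assms(4) by simp
  then have "(f x)\<^sup>2 < c\<^sup>2" using assms(2) by simp
  then show ?thesis by (rule power2_less_imp_less) (use assms(3) in simp)
qed

text \<open>Conditioning on \<open>U\<close> multiplies \<pi> by at most 1/\<pi>(U), so by Jensen
  the squared average is at most the second moment over \<pi>(U).\<close>

lemma restricted_average_le:
  assumes U: "p \<le> measure_pmf.prob \<pi> U" and "0 < p" and "0 < c"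
    and var: "(\<Sum>x\<in>UNIV. pmf \<pi> x * (f x)\<^sup>2) \<le> p * c\<^sup>2"
  shows "(\<Sum>y\<in>UNIV. restricted \<pi> U {y} * f y) \<le> c"
proof -
  define u where "u = measure_pmf.prob \<pi> U"
  have u: "p \<le> u" "0 < u" using assms by (auto simp: u_def)
  define w where "w y = restricted \<pi> U {y}" for y
  have w: "w y = indicator U y * pmf \<pi> y / u" for y
    by (auto simp: w_def restricted_def u_def indicator_def prob_eq_sum_pmf Int_insert_right)
  have "sum w UNIV = 1"
    using sum_pmf_indicator[of U] u
    by (simp add: w sum_divide_distrib[symmetric] mult.commute u_def)
  then have "(\<Sum>y\<in>UNIV. w y * f y)\<^sup>2 \<le> (\<Sum>y\<in>UNIV. w y * (f y)\<^sup>2)"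
    using u by (intro weighted_sum_square_le) (auto simp: w)
  also have "\<dots> \<le> (\<Sum>y\<in>UNIV. pmf \<pi> y * (f y)\<^sup>2 / u)"
    using u by (intro sum_mono) (auto simp: w indicator_def divide_right_mono)
  also have "\<dots> \<le> p * c\<^sup>2 / u"
    using var u by (simp add: sum_divide_distrib[symmetric] divide_right_mono)
  also have "\<dots> \<le> u * c\<^sup>2 / u"
    using u by (intro divide_right_mono mult_right_mono) auto
  also have "\<dots> = c\<^sup>2" using u by simp
  finally have "(\<Sum>y\<in>UNIV. w y * f y) \<le> c"
    by (rule power2_le_imp_le) (use \<open>0 < c\<close> in simp)
  then show ?thesis by (simp add: w_def)
qed

text \<open>With probability \<open>a\<close> the chain holds; otherwise it is resampled over some
  \<open>U\<close>, where \<open>restricted_average_le\<close> bounds the mean.\<close>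

lemma step_le_of_representation:
  assumes repr: "\<And>A. measure_pmf.prob (K x) A = a * indicator A x
           + (1 - a) * (\<Sum>U\<in>UNIV. pmf W U * restricted \<pi> U A)"
    and "a \<le> 1"
    and W: "\<And>U. pmf W U > 0 \<Longrightarrow> p \<le> measure_pmf.prob \<pi> U" and "0 < p" and "0 < c"
    and var: "(\<Sum>x\<in>UNIV. pmf \<pi> x * (f x)\<^sup>2) \<le> p * c\<^sup>2"
  shows "step f x \<le> a * f x + (1 - a) * c"
proof -
  have k: "pmf (K x) y = a * indicator {y} x
      + (1 - a) * (\<Sum>U\<in>UNIV. pmf W U * restricted \<pi> U {y})" for y
    using repr[of "{y}"] by (simp add: measure_pmf_single)
  have ind: "(\<Sum>y\<in>UNIV. indicator {y} x * f y) = f x"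
    by (simp add: indicator_def if_distrib if_distribR sum.If_cases cong: if_cong)
  have avg: "(\<Sum>U\<in>UNIV. pmf W U * (\<Sum>y\<in>UNIV. restricted \<pi> U {y} * f y)) \<le> (\<Sum>U\<in>UNIV. pmf W U * c)"
  proof (intro sum_mono)
    fix U
    show "pmf W U * (\<Sum>y\<in>UNIV. restricted \<pi> U {y} * f y) \<le> pmf W U * c"
    proof (cases "pmf W U > 0")
      case True
      then show ?thesis
        using restricted_average_le[OF W[OF True] \<open>0 < p\<close> \<open>0 < c\<close> var] by simp
    next
      case False
      \<comment> \<open>Here \<pi>(U) may be too small or zero, but the weight removes the
        term.\<close>
      then have "pmf W U = 0" by (simp add: order.antisym not_less)
      then show ?thesis by simp
    qed
  qed
  have "step f x = (\<Sum>y\<in>UNIV. a * (indicator {y} x * f y)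
      + (1 - a) * (\<Sum>U\<in>UNIV. pmf W U * (restricted \<pi> U {y} * f y)))"
    unfolding step_def k by (simp only: distrib_right sum_distrib_right mult.assoc)
  also have "\<dots> = a * f x
      + (1 - a) * (\<Sum>y\<in>UNIV. \<Sum>U\<in>UNIV. pmf W U * (restricted \<pi> U {y} * f y))"
    by (simp only: sum.distrib sum_distrib_left[symmetric] ind)
  also have "\<dots> = a * f x
      + (1 - a) * (\<Sum>U\<in>UNIV. pmf W U * (\<Sum>y\<in>UNIV. restricted \<pi> U {y} * f y))"
    by (subst sum.swap) (simp add: sum_distrib_left)
  also have "\<dots> \<le> a * f x + (1 - a) * (\<Sum>U\<in>UNIV. pmf W U * c)"
    using avg \<open>a \<le> 1\<close> by (intro add_left_mono mult_left_mono) auto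
  also have "\<dots> = a * f x + (1 - a) * c"
    by (simp add: sum_distrib_right[symmetric] sum_pmf_UNIV)
  finally show ?thesis .
qed

text \<open>\<open>a ^ n\<close> pays, at the trivial rate 1, for never being resampled in the first
  \<open>n\<close> steps; any resampling leaves at least \<open>t\<close> steps, where the variance
  bound holds.\<close>

lemma excess_le_holding:
  assumes repr: "\<And>A. measure_pmf.prob (K x) A = a * indicator A x
           + (1 - a) * (\<Sum>U\<in>UNIV. pmf W U * restricted \<pi> U A)"
    and a: "0 \<le> a" "a \<le> 1"
    and W: "\<And>U. pmf W U > 0 \<Longrightarrow> p \<le> measure_pmf.prob \<pi> U" and "0 < p" and "0 < c"
    and var: "\<And>s. t \<le> s \<Longrightarrow> (\<Sum>x\<in>UNIV. pmf \<pi> x * (excess A s x)\<^sup>2) \<le> p * c\<^sup>2"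
  shows "excess A (t + n) x \<le> a ^ n + c"
proof (induction n)
  case 0
  show ?case using excess_le_1[of A t x] \<open>0 < c\<close> by simp
next
  case (Suc n)
  have "excess A (t + Suc n) x \<le> a * excess A (t + n) x + (1 - a) * c"
    using step_le_of_representation[OF repr a(2) W \<open>0 < p\<close> \<open>0 < c\<close> var, of "t + n"]
    by (simp add: excess_Suc)
  also have "\<dots> \<le> a * (a ^ n + c) + (1 - a) * c"
    using Suc a by (intro add_right_mono mult_left_mono) auto
  finally show ?case by (simp add: algebra_simps)
qed

section \<open>Escape from a set and the lower bound\<close>

text \<open>A union bound over time: each step out of \<open>S\<close> costs at most the boundary
  flow, and the mass staying in \<open>S\<close> remains dominated by \<pi>.\<close>

lemma escape_le:
  "(\<Sum>x\<in>S. pmf \<pi> x * measure_pmf.prob (kernel_pow K t x) (- S)) \<le> t * set_flow K \<pi> S (- S)"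
proof (induction t)
  case (Suc t)
  define u where "u x = measure_pmf.prob (kernel_pow K t x) (- S)" for x
  have "(\<Sum>x\<in>S. pmf \<pi> x * measure_pmf.prob (kernel_pow K (Suc t) x) (- S))
      = (\<Sum>x\<in>S. \<Sum>y\<in>UNIV. flow x y * u y)"
    unfolding prob_kernel_pow_Suc
    by (simp add: step_def ergodic_flow_def sum_distrib_left u_def mult.assoc)
  also have "\<dots> = (\<Sum>x\<in>S. (\<Sum>y\<in>S. flow x y * u y) + (\<Sum>y\<in>-S. flow x y * u y))"
    by (intro sum.cong refl)
      (metis Compl_disjoint Compl_partition finite sum.union_disjoint)
  also have "\<dots> = (\<Sum>y\<in>S. \<Sum>x\<in>S. flow x y * u y) + (\<Sum>x\<in>S. \<Sum>y\<in>-S. flow x y * u y)"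
    unfolding sum.distrib by (subst sum.swap) simp
  \<comment> \<open>Enlarging the first sum to all \<open>x\<close> restores the stationary weight
    of \<open>y\<close>; in the second, \<open>u y\<close> is at most 1.\<close>
  also have "\<dots> \<le> (\<Sum>y\<in>S. \<Sum>x\<in>UNIV. flow x y * u y) + (\<Sum>x\<in>S. \<Sum>y\<in>-S. flow x y * 1)"
    by (intro add_mono sum_mono mult_left_mono flow_nonneg sum_mono2)
      (auto simp: u_def flow_nonneg)
  also have "\<dots> = (\<Sum>y\<in>S. pmf \<pi> y * u y) + set_flow K \<pi> S (- S)"
    by (simp add: set_flow_def sum_distrib_right[symmetric] sum_flow_left)
  also have "\<dots> \<le> t * set_flow K \<pi> S (- S) + set_flow K \<pi> S (- S)"
    using Suc by (simp add: u_def)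
  finally show ?case by (simp add: algebra_simps)
qed (simp add: indicator_def)

text \<open>Strictness survives the supremum because there are only finitely many sets
  \<open>A\<close>.\<close>

lemma tv_dist_less:
  assumes "\<And>A. measure_pmf.prob \<mu> A - measure_pmf.prob \<nu> A < c"
  shows "tv_dist (\<mu> :: 'a pmf) \<nu> < c"
  unfolding tv_dist_def using assms by (subst finite_imp_Sup_less) auto

lemma prob_diff_le_tv_dist:
  "measure_pmf.prob \<mu> A - measure_pmf.prob \<nu> A \<le> tv_dist (\<mu> :: 'a pmf) \<nu>"
  unfolding tv_dist_def by (intro cSUP_upper bdd_above_finite) auto

text \<open>A mixed chain is in \<open>S\<close> with probability below 1/2 + 1/4 from every start;
  averaging the escape probability over \<open>S\<close> then contradicts \<open>escape_le\<close>
  if \<open>t\<close> is small.\<close>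

lemma mixing_time_lower:
  assumes mixed: "(SUP x. tv_dist (kernel_pow K t x) \<pi>) < 1 / 4"
    and S: "0 < measure_pmf.prob \<pi> S" "measure_pmf.prob \<pi> S \<le> 1 / 2"
  shows "1 / 4 < t * set_conductance K \<pi> S"
proof -
  define s where "s = measure_pmf.prob \<pi> S"
  have gt: "1 / 4 < measure_pmf.prob (kernel_pow K t x) (- S)" for x
  proof -
    have "measure_pmf.prob (kernel_pow K t x) S - measure_pmf.prob \<pi> S
        \<le> tv_dist (kernel_pow K t x) \<pi>"
      by (rule prob_diff_le_tv_dist)
    also have "\<dots> \<le> (SUP x. tv_dist (kernel_pow K t x) \<pi>)"
      by (intro cSUP_upper bdd_above_finite) auto
    finally have "measure_pmf.prob (kernel_pow K t x) S < 3 / 4"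
      using mixed S by simp
    then show ?thesis
      using measure_pmf.prob_compl[of S "kernel_pow K t x"] by (simp add: Compl_eq_Diff_UNIV)
  qed
  \<comment> \<open>A point of positive mass keeps the averaged inequality strict.\<close>
  obtain z where z: "z \<in> S" "pmf \<pi> z > 0"
    using S(1) by (metis (no_types, lifting) less_irrefl pmf_nonneg order_le_less
        prob_eq_sum_pmf sum.neutral)
  have "(\<Sum>x\<in>S. pmf \<pi> x * (1 / 4))
      < (\<Sum>x\<in>S. pmf \<pi> x * measure_pmf.prob (kernel_pow K t x) (- S))"
  proof (rule sum_strict_mono_ex1)
    show "\<forall>x\<in>S. pmf \<pi> x * (1 / 4) \<le> pmf \<pi> x * measure_pmf.prob (kernel_pow K t x) (- S)"
      using gt less_imp_le by (intro ballI mult_left_mono) auto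
    show "\<exists>x\<in>S. pmf \<pi> x * (1 / 4) < pmf \<pi> x * measure_pmf.prob (kernel_pow K t x) (- S)"
      using z gt by (intro bexI[of _ z] mult_strict_left_mono) auto
  qed simp
  also have "\<dots> \<le> t * set_flow K \<pi> S (- S)" by (rule escape_le)
  finally have "s / 4 < t * set_flow K \<pi> S (- S)"
    by (simp add: s_def prob_eq_sum_pmf sum_divide_distrib)
  then show ?thesis
    using S by (simp add: set_conductance_def s_def field_simps)
qed

text \<open>The infimum runs over finitely many sets, and finiteness of its value rules out the
  empty family.\<close>

lemma conductance_attained:
  assumes "conductance K \<pi> < \<infinity>"
  obtains S where "0 < measure_pmf.prob \<pi> S" "measure_pmf.prob \<pi> S \<le> 1 / 2"
    "conductance K \<pi> = ereal (set_conductance K \<pi> S)"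
proof -
  define F where "F = {S. 0 < measure_pmf.prob \<pi> S \<and> measure_pmf.prob \<pi> S \<le> 1 / 2}"
  have c: "conductance K \<pi> = (INF S\<in>F. ereal (set_conductance K \<pi> S))"
    by (simp add: conductance_def F_def)
  have "F \<noteq> {}" using assms by (auto simp: c top_ereal_def)
  then have "conductance K \<pi> = Min ((\<lambda>S. ereal (set_conductance K \<pi> S)) ` F)"
    unfolding c by (intro cInf_eq_Min) auto
  moreover have "Min ((\<lambda>S. ereal (set_conductance K \<pi> S)) ` F)
      \<in> (\<lambda>S. ereal (set_conductance K \<pi> S)) ` F"
    using \<open>F \<noteq> {}\<close> by (intro Min_in) auto
  ultimately show thesis using that by (auto simp: F_def)
qed

end

section \<open>Range of \<open>pi_star\<close>\<close>

lemma pi_star_le: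
  fixes \<pi> :: "'a::finite pmf"
  assumes "pmf (W x) U > 0"
  shows "pi_star \<pi> W \<le> measure_pmf.prob \<pi> U"
  unfolding pi_star_def using assms
  by (intro cInf_lower bdd_belowI[of _ 0]) auto

text \<open>Only finitely many values occur, so the infimum is one of them.\<close>

lemma pi_star_pos:
  fixes \<pi> :: "'a::finite pmf"
  assumes "\<And>x U. pmf (W x) U > 0 \<Longrightarrow> measure_pmf.prob \<pi> U > 0"
  shows "0 < pi_star \<pi> W"
proof -
  define X where "X = {measure_pmf.prob \<pi> U | U. \<exists>x. pmf (W x) U > 0}"
  \<comment> \<open>\<open>undefined\<close> is just some state; supports are nonempty, hence so is
    \<open>X\<close>.\<close>
  obtain U where "U \<in> set_pmf (W undefined)" using set_pmf_not_empty by fast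
  then have "measure_pmf.prob \<pi> U \<in> X"
    by (auto simp: X_def pmf_positive_iff)
  moreover have "finite X"
    by (rule finite_subset[of _ "range (measure_pmf.prob \<pi>)"]) (auto simp: X_def)
  ultimately have "pi_star \<pi> W \<in> X"
    unfolding pi_star_def X_def[symmetric] by (metis Min_in cInf_eq_Min empty_iff)
  then show ?thesis using assms by (auto simp: X_def)
qed

lemma pi_star_le_1:
  fixes \<pi> :: "'a::finite pmf"
  shows "pi_star \<pi> W \<le> 1"
proof -
  obtain U where "U \<in> set_pmf (W undefined)" using set_pmf_not_empty by fast
  then have "pi_star \<pi> W \<le> measure_pmf.prob \<pi> U"
    by (intro pi_star_le) (auto simp: pmf_positive_iff)
  then show ?thesis by (meson measure_pmf.prob_le_1 order_trans)
qed

section \<open>Both bounds on the mixing time\<close>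

theorem theorem2:
  fixes K :: "'a::finite \<Rightarrow> 'a pmf" and \<pi> :: "'a pmf"
    and W :: "'a \<Rightarrow> 'a set pmf" and \<alpha> :: "'a \<Rightarrow> real"
    and \<beta> \<gamma> :: real
  assumes lazy: "half_lazy K"
    and rev: "reversible K \<pi>"
    and stat: "stationary K \<pi>"
    and full_support: "\<And>x. pmf \<pi> x > 0"
    and beta: "0 < \<beta>" "\<beta> < 1"
    and gamma: "0 < \<gamma>" "\<gamma> < 1"
    and small_sets: "\<And>S y. measure_pmf.prob \<pi> S \<le> \<beta> \<Longrightarrow> pmf \<pi> y > 0 \<Longrightarrow>
           (\<Sum>x\<in>S. ergodic_flow K \<pi> x y) / pmf \<pi> y \<le> 1 - \<gamma>"
    and alpha: "\<And>x. 1 / 2 \<le> \<alpha> x" "\<And>x. \<alpha> x < 1"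
    and W_pos: "\<And>x U. pmf (W x) U > 0 \<Longrightarrow> measure_pmf.prob \<pi> U > 0"
    and repr: "\<And>x A. measure_pmf.prob (K x) A =
           \<alpha> x * indicator A x
           + (1 - \<alpha> x) * (\<Sum>U\<in>UNIV. pmf (W x) U * restricted \<pi> U A)"
    and cond: "conductance K \<pi> \<le> ereal (1 / 4)"
  shows "1 / (4 * conductance K \<pi>) \<le> mixing_time K \<pi> \<and>
         mixing_time K \<pi> \<le>
           32 / (ereal \<gamma> * (conductance K \<pi>)\<^sup>2)
             * ereal (ln (4 / pi_star \<pi> W)) * ereal (ln (2 / sqrt \<beta>))"
proof -
  interpret reversible_chain K \<pi> by unfold_locales (rule rev)
  have "conductance K \<pi> < \<infinity>" using cond by (cases "conductance K \<pi>") auto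
  then obtain S where S: "0 < measure_pmf.prob \<pi> S" "measure_pmf.prob \<pi> S \<le> 1 / 2"
    and cS: "conductance K \<pi> = ereal (set_conductance K \<pi> S)"
    by (rule conductance_attained)
  define \<phi> where "\<phi> = set_conductance K \<pi> S"
  have c: "conductance K \<pi> = ereal \<phi>" using cS by (simp add: \<phi>_def)
  have \<phi>_nonneg: "0 \<le> \<phi>"
    using set_flow_nonneg by (simp add: \<phi>_def set_conductance_def)
  have \<phi>_le: "\<phi> \<le> 1 / 4" using cond c by simp
  have lower: "1 / (4 * conductance K \<pi>) \<le> mixing_time K \<pi>"
    unfolding mixing_time_def
  proof (rule INF_greatest)
    fix t assume "t \<in> {t. (SUP x. tv_dist (kernel_pow K t x) \<pi>) < 1 / 4}"
    then have *: "1 / 4 < t * \<phi>"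
      unfolding \<phi>_def using mixing_time_lower S by blast
    \<comment> \<open>If \<phi> is zero, no admissible \<open>t\<close> exists and both sides are
      infinite.\<close>
    then have "\<phi> \<noteq> 0" by auto
    with * \<phi>_nonneg have "1 / (4 * \<phi>) \<le> t" by (simp add: field_simps)
    moreover have "1 / (4 * conductance K \<pi>) = ereal (1 / (4 * \<phi>))"
      using \<open>\<phi> \<noteq> 0\<close> by (simp add: c one_ereal_def)
    ultimately show "1 / (4 * conductance K \<pi>) \<le> ereal (real t)" by simp
  qed
  define p where "p = pi_star \<pi> W"
  have p: "0 < p" "p \<le> 1" using pi_star_pos[of W \<pi>] W_pos pi_star_le_1 by (auto simp: p_def)
  define L where "L = ln (4 / p)"
  define M where "M = ln (2 / sqrt \<beta>)"
  have ln2: "ln 2 \<ge> (2 / 3 :: real)" using ln2_ge_two_thirds .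
  have ln4: "ln 4 = 2 * ln (2 :: real)" using ln_realpow[of 2 2] by simp
  have ln8: "ln 8 = 3 * ln (2 :: real)" using ln_realpow[of 2 3] by simp
  have L: "2 * ln 2 \<le> L"
    unfolding L_def ln4[symmetric] using p by (subst ln_le_cancel_iff) (auto simp: field_simps)
  have M: "ln 2 \<le> M"
    unfolding M_def using beta by (subst ln_le_cancel_iff) (auto simp: field_simps)
  show ?thesis
  proof (cases "\<phi> = 0")
    case True
    \<comment> \<open>In \<open>ereal\<close> zero times infinity is zero, so positive logarithms
      are what keeps the right side infinite.\<close>
    have "L > 0" "M > 0" using L M ln2 by auto
    then have "32 / (ereal \<gamma> * (conductance K \<pi>)\<^sup>2) * ereal L * ereal M = \<infinity>"
      using True by (simp add: c power2_eq_square divide_ereal_def)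
    then show ?thesis using lower by (simp add: L_def M_def p_def)
  next
    case False
    with \<phi>_nonneg have \<phi>_pos: "0 < \<phi>" by simp
    have \<phi>2: "0 < \<phi>\<^sup>2" "\<phi>\<^sup>2 \<le> 1 / 16"
      using \<phi>_pos power_mono[OF \<phi>_le \<phi>_nonneg, of 2] by (auto simp: power_divide)
    \<comment> \<open>\<open>T\<close> is the claimed bound and \<open>t\<close> its integer part.
      The first \<open>n\<close> steps wait for a resampling; the last \<open>b\<close> bring the
      variance down to \<open>p / 64\<close>.\<close>
    define T where "T = 32 / (\<gamma> * \<phi>\<^sup>2) * L * M"
    define t where "t = nat \<lfloor>T\<rfloor>"
    define b where "b = nat \<lfloor>4 * L / \<phi>\<^sup>2\<rfloor> + 1"
    define n where "n = t - b"
    have T_eq: "32 / (ereal \<gamma> * (conductance K \<pi>)\<^sup>2) * ereal L * ereal M = ereal T"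
      using \<phi>_pos gamma by (simp add: c T_def power2_eq_square)
    have L_pos: "0 < L" and M_pos: "0 < M" using L M ln2 by auto
    have b: "4 * L / \<phi>\<^sup>2 < b" "b \<le> 4 * L / \<phi>\<^sup>2 + 1"
      unfolding b_def using L_pos by (auto simp: nat_less_iff) linarith+
    have x: "16 \<le> 1 / \<phi>\<^sup>2" using \<phi>2 by (simp add: field_simps)
    have y: "1 \<le> 1 / \<gamma>" using gamma by (simp add: field_simps)
    have "1 / \<phi>\<^sup>2 \<le> 1 / \<phi>\<^sup>2 * (1 / \<gamma>)" using mult_left_mono[OF y, of "1 / \<phi>\<^sup>2"] by simp
    moreover have "16 * (1 / \<gamma>) \<le> 1 / \<phi>\<^sup>2 * (1 / \<gamma>)" using mult_right_mono[OF x, of "1 / \<gamma>"] gamma by simp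
    moreover define Z where "Z = 1 / \<phi>\<^sup>2 * (1 / \<gamma>)"
    ultimately have Z: "1 / \<phi>\<^sup>2 \<le> Z" "16 * (1 / \<gamma>) \<le> Z" "16 \<le> Z" using x by auto
    have T: "T = 32 * Z * (L * M)" by (simp add: T_def Z_def mult_ac)
    \<comment> \<open>Replacing one logarithm by its minimum, 4/3 for \<open>L\<close> or 2/3 for
      \<open>M\<close>, gives the linear bounds \<open>T1\<close> and \<open>T2\<close>.\<close>
    have LM: "4 / 3 * M \<le> L * M" "2 / 3 * L \<le> L * M"
      using L M ln2 mult_right_mono[of "4 / 3" L M] mult_left_mono[of "2 / 3" M L] L_pos M_pos
      by (auto simp: mult.commute)
    \<comment> \<open>These absorb the rounding errors in \<open>t\<close> and \<open>b\<close>; the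
      16 comes from \<phi> \<le> 1/4.\<close>
    have ZL: "16 * (4 / 3) \<le> Z * L" using Z L ln2 by (intro mult_mono) auto
    have ZM: "16 * (2 / 3) \<le> Z * M" using Z M ln2 by (intro mult_mono) auto
    have T1: "128 / 3 * (Z * M) \<le> T"
      using mult_left_mono[OF LM(1), of "32 * Z"] Z by (simp add: T)
    have T2: "64 / 3 * (Z * L) \<le> T"
      using mult_left_mono[OF LM(2), of "32 * Z"] Z by (simp add: T)
    have t: "T - 1 < t" "t \<le> T"
      unfolding t_def using T2 ZL by linarith+
    have "1 / \<phi>\<^sup>2 * M \<le> Z * M" using Z M_pos by (intro mult_right_mono) auto
    then have t_large: "4 * M / \<phi>\<^sup>2 < t" using t T1 ZM by simp
    have "1 / \<phi>\<^sup>2 * L \<le> Z * L" using Z L_pos by (intro mult_right_mono) auto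
    then have bT: "b \<le> 4 * (Z * L) + 1" using b by simp
    have "b \<le> t" using bT t T2 ZL by linarith
    then have n: "real n = t - b" by (simp add: n_def)
    \<comment> \<open>Aim: \<open>n\<close> exceeds \<open>ln 8 / \<gamma>\<close>, so that holding
      for \<open>n\<close> steps has probability below 1/8.\<close>
    have "4 / 3 * (16 * (1 / \<gamma>)) \<le> L * Z"
      using L ln2 Z gamma by (intro mult_mono) auto
    moreover have "ln 8 \<le> (3 :: real)" using ln8 ln_add_one_self_le_self[of 1] by simp
    then have "ln 8 / \<gamma> \<le> 3 * (1 / \<gamma>)" using gamma by (simp add: divide_right_mono)
    ultimately have "ln 8 / \<gamma> < n" using n bT t T2 ZL by (simp add: mult.commute)
    then have n_large: "ln 8 < \<gamma> * n" using gamma by (simp add: field_simps)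
    have variance: "(\<Sum>x\<in>UNIV. pmf \<pi> x * (excess A s x)\<^sup>2) \<le> exp (- (\<phi>\<^sup>2 * s / 2)) / 4" for A s
      using excess_variance_le[OF lazy, of \<phi>] c \<phi>_nonneg \<phi>_le by simp
    have "excess A t x < 1 / 4" for A x
    proof (cases "\<beta> \<le> pmf \<pi> x")
      case True
      \<comment> \<open>The square root in \<open>M\<close> makes \<open>exp (- (2 * M))\<close>
        equal to \<beta>/4, so the variance drops below \<beta>/16.\<close>
      have "exp (- (\<phi>\<^sup>2 * t / 2)) < exp (- (2 * M))"
        using t_large \<phi>_pos by (simp add: field_simps)
      also have "\<dots> = (exp M) powr (- 2)" by (simp add: powr_def)
      also have "\<dots> = \<beta> / 4"
        using beta by (simp add: M_def powr_minus powr_numeral power_divide)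
      finally have "exp (- (\<phi>\<^sup>2 * t / 2)) / 4 < \<beta> * (1 / 4)\<^sup>2"
        by (simp add: power2_eq_square)
      then show ?thesis
        using excess_le_of_large_atom[OF True beta(1), of "1 / 4" "excess A t"] variance[of A t]
        by simp
    next
      case False
      have "\<alpha> x \<le> pmf (K x) x"
      proof -
        have "0 \<le> (\<Sum>U\<in>UNIV. pmf (W x) U * restricted \<pi> U {x})"
          by (intro sum_nonneg) (auto simp: restricted_def)
        then have "0 \<le> (1 - \<alpha> x) * (\<Sum>U\<in>UNIV. pmf (W x) U * restricted \<pi> U {x})"
          using alpha(2)[of x] by (intro mult_nonneg_nonneg) auto
        then show ?thesis
          using repr[of x "{x}"] by (simp add: measure_pmf_single)
      qed
      \<comment> \<open>For \<open>S = {x}\<close> and \<open>y = x\<close> the quotient in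
        \<open>small_sets\<close> is K(x,x).\<close>
      also have "\<dots> \<le> 1 - \<gamma>"
        using small_sets[of "{x}" x] False full_support[of x]
        by (simp add: ergodic_flow_def measure_pmf_single)
      also have "\<dots> \<le> exp (- \<gamma>)" using exp_ge_add_one_self[of "- \<gamma>"] by simp
      finally have "\<alpha> x ^ n \<le> exp (- \<gamma>) ^ n"
        using alpha(1)[of x] by (intro power_mono) auto
      also have "\<dots> = exp (- (\<gamma> * n))" by (simp add: exp_of_nat_mult[symmetric] mult.commute)
      also have "\<dots> < exp (- ln 8)" using n_large by simp
      also have "\<dots> = 1 / 8" by (simp add: exp_minus)
      finally have hold: "\<alpha> x ^ n < 1 / 8" .
      have var: "(\<Sum>x\<in>UNIV. pmf \<pi> x * (excess A s x)\<^sup>2) \<le> p * (1 / 8)\<^sup>2" if "b \<le> s" for s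
      proof -
        have "4 * L / \<phi>\<^sup>2 < s" using b(1) that by linarith
        then have "exp (- (\<phi>\<^sup>2 * s / 2)) \<le> exp (- (2 * L))"
          using \<phi>_pos by (simp add: field_simps)
        also have "\<dots> = (exp L) powr (- 2)" by (simp add: powr_def)
        also have "\<dots> = p * p / 16"
          using p by (simp add: L_def powr_minus powr_numeral power_divide power2_eq_square)
        also have "\<dots> \<le> p * 1 / 16"
          using p by (intro divide_right_mono mult_left_mono) auto
        finally show ?thesis using variance[of A s] by (simp add: power2_eq_square)
      qed
      \<comment> \<open>The allowance 1/4 is split evenly: below 1/8 for holding, 1/8 for resampled
        averages.\<close>
      have "excess A (b + n) x \<le> \<alpha> x ^ n + 1 / 8"
      proof (rule excess_le_holding[where W = "W x" and p = p])
        show "p \<le> measure_pmf.prob \<pi> U" if "pmf (W x) U > 0" for U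
          unfolding p_def using that by (rule pi_star_le)
      qed (use repr alpha[of x] p var in auto)
      then show ?thesis using hold \<open>b \<le> t\<close> by (simp add: n_def)
    qed
    then have "tv_dist (kernel_pow K t x) \<pi> < 1 / 4" for x
      by (intro tv_dist_less) (simp add: excess_def)
    then have "(SUP x. tv_dist (kernel_pow K t x) \<pi>) < 1 / 4"
      by (subst finite_imp_Sup_less) auto
    then have "mixing_time K \<pi> \<le> ereal t"
      unfolding mixing_time_def by (intro INF_lower) simp
    also have "\<dots> \<le> ereal T" using t by simp
    finally show ?thesis
      using lower T_eq by (simp add: L_def M_def p_def)
  qed
qed

end
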